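(* Let $\mathcal{A}$ be a finite-dimensional nilpotent evolution algebra over a field $\mathbb{K}$ with a natural basis $B=\{e_i\}_{i\in\Lambda}$, let $\mathfrak{m}=\operatorname{asi}(\mathcal{A})$ and let $[n_1,\dots,n_{\mathfrak{m}}]$ be the type of $\mathcal{A}$. Then $$n_i=|\lambda_i(B)|-|\lambda_{i-1}(B)|\quad\text{for all } i\in\{1,\dots,\mathfrak{m}\}.$$
   Context: An evolution algebra over a field $\mathbb{K}$ (arbitrary characteristic) is a $\mathbb{K}$-algebra $\mathcal{A}$ (not necessarily associative) admitting a basis $B=\{e_i\}_{i\in\Lambda}$, called a natural basis, with $e_ie_j=0$ for $i\neq j$ and $e_i^2=\sum_{k\in\Lambda} w_{ik}e_k$, where $w_{ik}\in\mathbb{K}$. All algebras are finite-dimensional. For $i\in\Lambda$, $D^1(i)=\{k\in\Lambda : w_{ik}\neq 0\}$. Define $\lambda_0(B)=\emptyset$, $\lambda_1(B)=\{i\in\Lambda : e_i^2=0\}$ and $\lambda_k(B)=\{i\in\Lambda : D^1(i)\subseteq\lambda_{k-1}(B)\}$ for $k>1$. The annihilator is $\operatorname{ann}(\mathcal{A})=\{x\in\mathcal{A}: x\mathcal{A}=\{0\}\}$. The upper annihilating series is defined by $\operatorname{ann}^{(0)}(\mathcal{A})=\{0\}$ and $\operatorname{ann}^{(i)}(\mathcal{A})/\operatorname{ann}^{(i-1)}(\mathcal{A})=\operatorname{ann}(\mathcal{A}/\operatorname{ann}^{(i-1)}(\mathcal{A}))$. The annihilator stabilizing index is $\operatorname{asi}(\mathcal{A})=\min\{q\ge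 0:\operatorname{ann}^{(q)}(\mathcal{A})=\operatorname{ann}^{(q+1)}(\mathcal{A})\}$. $\mathcal{A}$ is nilpotent if $\mathcal{A}^n=0$ for some $n$, where $\mathcal{A}^1=\mathcal{A}$ and $\mathcal{A}^n=\sum_{i=1}^{n-1}\mathcal{A}^i\mathcal{A}^{n-i}$. If $\mathcal{A}$ is a nilpotent evolution algebra and $r=\operatorname{asi}(\mathcal{A})$, the type of $\mathcal{A}$ is the sequence $[n_1,\dots,n_r]$ such that $n_1+\dots+n_i=\dim(\operatorname{ann}^{(i)}(\mathcal{A}))$ for all $i\in\{1,\dots,r\}$. *)

theory Defs
  imports Complex_Main
begin

text \<open>
  Algebras live on a whole type \<open>'a\<close>, with scalar multiplication \<open>scale\<close> over a field \<open>'k\<close> of any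
  characteristic and a bilinear product \<open>mult\<close>. The annihilator takes carrier, product and zero
  explicitly so that it also applies to quotient algebras, whose elements are cosets.
\<close>

definition annihilator :: "'b set \<Rightarrow> ('b \<Rightarrow> 'b \<Rightarrow> 'b) \<Rightarrow> 'b \<Rightarrow> 'b set" where
  "annihilator A m z = {x \<in> A. m x ` A = {z}}"

locale nonassoc_algebra = vector_space scale
  for scale :: "'k::field \<Rightarrow> 'a::ab_group_add \<Rightarrow> 'a" +
  fixes mult :: "'a \<Rightarrow> 'a \<Rightarrow> 'a"
  assumes mult_linear_left: "Vector_Spaces.linear scale scale (\<lambda>x. mult x y)"
    and mult_linear_right: "Vector_Spaces.linear scale scale (\<lambda>y. mult x y)"
begin

definition congr :: "'a set \<Rightarrow> ('a \<times> 'a) set" where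
  "congr I = {(x, y). x - y \<in> I}"

definition coset :: "'a set \<Rightarrow> 'a \<Rightarrow> 'a set" where
  "coset I x = congr I `` {x}"

definition quot :: "'a set \<Rightarrow> 'a set set" where
  "quot I = UNIV // congr I"

text \<open>For an ideal \<open>I\<close> all the cosets in this union coincide; see \<open>quot_mult_coset\<close> below.\<close>

definition quot_mult :: "'a set \<Rightarrow> 'a set \<Rightarrow> 'a set \<Rightarrow> 'a set" where
  "quot_mult I X Y = (\<Union>x\<in>X. \<Union>y\<in>Y. coset I (mult x y))"

text \<open>
  \<open>upper_ann (Suc i)\<close> is the full preimage of \<open>ann(A/upper_ann i)\<close> under the projection, i.e. the
  subspace containing \<open>upper_ann i\<close> whose quotient by it is that annihilator; see
  \<open>upper_ann_quot\<close> below.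
\<close>

primrec upper_ann :: "nat \<Rightarrow> 'a set" where
  "upper_ann 0 = {0}"
| "upper_ann (Suc i) =
    {x. coset (upper_ann i) x \<in>
        annihilator (quot (upper_ann i)) (quot_mult (upper_ann i)) (coset (upper_ann i) 0)}"

definition asi :: nat where
  "asi = (LEAST q. upper_ann q = upper_ann (Suc q))"

definition subspace_mult :: "'a set \<Rightarrow> 'a set \<Rightarrow> 'a set" where
  "subspace_mult U V = span {mult x y | x y. x \<in> U \<and> y \<in> V}"

text \<open>
  The span of the union is the sum of the subspaces. The value at exponent \<open>0\<close> is a dummy.
\<close>

function alg_power :: "nat \<Rightarrow> 'a set" where
  "alg_power n = (if n \<le> 1 then UNIV
     else span (\<Union>i\<in>{1..n - 1}. subspace_mult (alg_power i) (alg_power (n - i))))"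
  by auto
termination by (relation "Wellfounded.measure id") auto

declare alg_power.simps [simp del]

definition nilpotent :: bool where
  "nilpotent \<longleftrightarrow> (\<exists>n\<ge>1. alg_power n = {0})"

text \<open>
  The list is indexed from \<open>0\<close>: \<open>n\<^sub>i\<close> is \<open>ns ! (i - 1)\<close>.
\<close>

definition is_type :: "nat list \<Rightarrow> bool" where
  "is_type ns \<longleftrightarrow> length ns = asi \<and>
     (\<forall>i\<in>{1..asi}. (\<Sum>j = 1..i. ns ! (j - 1)) = dim (upper_ann i))"

end

text \<open>
  A finite-dimensional algebra together with a natural basis \<open>e\<close> indexed by \<open>\<Lambda>\<close>. The coefficients
  \<open>w i k\<close> matter (and are determined) only for indices in \<open>\<Lambda>\<close>.
\<close>

locale evolution_algebra = nonassoc_algebra scale mult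
  for scale :: "'k::field \<Rightarrow> 'a::ab_group_add \<Rightarrow> 'a" and mult :: "'a \<Rightarrow> 'a \<Rightarrow> 'a" +
  fixes \<Lambda> :: "'i set" and e :: "'i \<Rightarrow> 'a" and w :: "'i \<Rightarrow> 'i \<Rightarrow> 'k"
  assumes finite_index: "finite \<Lambda>"
    and inj_basis: "inj_on e \<Lambda>"
    and independent_basis: "independent (e ` \<Lambda>)"
    and span_basis: "span (e ` \<Lambda>) = UNIV"
    and mult_basis_distinct: "\<lbrakk>i \<in> \<Lambda>; j \<in> \<Lambda>; i \<noteq> j\<rbrakk> \<Longrightarrow> mult (e i) (e j) = 0"
    and mult_basis_square: "i \<in> \<Lambda> \<Longrightarrow> mult (e i) (e i) = (\<Sum>k\<in>\<Lambda>. scale (w i k) (e k))"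
begin

definition D1 :: "'i \<Rightarrow> 'i set" where
  "D1 i = {k \<in> \<Lambda>. w i k \<noteq> 0}"

fun lambda_set :: "nat \<Rightarrow> 'i set" where
  "lambda_set 0 = {}"
| "lambda_set (Suc 0) = {i \<in> \<Lambda>. mult (e i) (e i) = 0}"
| "lambda_set (Suc (Suc k)) = {i \<in> \<Lambda>. D1 i \<subseteq> lambda_set (Suc k)}"

lemma mult_simps:
  "mult (x + x') y = mult x y + mult x' y" "mult x (y + y') = mult x y + mult x y'"
  "mult (scale c x) y = scale c (mult x y)" "mult x (scale c y) = scale c (mult x y)"
  "mult 0 y = 0" "mult x 0 = 0"
  "mult (x - x') y = mult x y - mult x' y" "mult x (y - y') = mult x y - mult x y'"
proof -
  interpret l: Vector_Spaces.linear scale scale "\<lambda>x. mult x y" for y by (rule mult_linear_left)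
  interpret r: Vector_Spaces.linear scale scale "\<lambda>y. mult x y" for x by (rule mult_linear_right)
  show "mult (x + x') y = mult x y + mult x' y" "mult x (y + y') = mult x y + mult x y'"
    "mult (scale c x) y = scale c (mult x y)" "mult x (scale c y) = scale c (mult x y)"
    "mult 0 y = 0" "mult x 0 = 0"
    "mult (x - x') y = mult x y - mult x' y" "mult x (y - y') = mult x y - mult x y'"
    by (simp_all add: l.add r.add l.scale r.scale l.zero r.zero l.diff r.diff)
qed

lemma mult_commute: "mult x y = mult y x"
proof -
  have b: "mult (e i) y = mult y (e i)" if i: "i \<in> \<Lambda>" for i y
  proof -
    have "y \<in> span (e ` \<Lambda>)" by (simp add: span_basis)
    then show ?thesis
    proof (induction rule: span_induct_alt)
      case (step c b v)
      then obtain j where "j \<in> \<Lambda>" "b = e j" by auto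
      then have "mult (e i) b = mult b (e i)"
        using i mult_basis_distinct by (cases "i = j") auto
      then show ?case using step by (simp add: mult_simps)
    qed (simp add: mult_simps)
  qed
  have "x \<in> span (e ` \<Lambda>)" by (simp add: span_basis)
  then show ?thesis
    by (induction rule: span_induct_alt) (auto simp: mult_simps b)
qed

definition ideal :: "'a set \<Rightarrow> bool" where
  "ideal I \<longleftrightarrow> subspace I \<and> (\<forall>x\<in>I. \<forall>y. mult x y \<in> I)"

lemma coset_eq_iff:
  assumes "ideal I" shows "coset I x = coset I y \<longleftrightarrow> x - y \<in> I"
proof -
  have s: "subspace I" using assms by (simp add: ideal_def)
  have "x \<in> coset I x" "y \<in> coset I y"
    using subspace_0[OF s] by (auto simp: coset_def congr_def)
  moreover have "u - v \<in> I \<longleftrightarrow> v - u \<in> I" for u v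
    using subspace_neg[OF s, of "u - v"] subspace_neg[OF s, of "v - u"] by auto
  moreover have "u - v \<in> I \<Longrightarrow> v - t \<in> I \<Longrightarrow> u - t \<in> I" for u v t
    using subspace_add[OF s, of "u - v" "v - t"] by simp
  ultimately show ?thesis unfolding coset_def congr_def by blast
qed

lemma quot_mult_coset:
  assumes "ideal I" shows "quot_mult I (coset I x) (coset I y) = coset I (mult x y)"
proof -
  have s: "subspace I" using assms by (simp add: ideal_def)
  have eq: "coset I (mult u v) = coset I (mult x y)"
    if "u \<in> coset I x" "v \<in> coset I y" for u v
  proof -
    have "mult (x - u) v \<in> I" "mult (y - v) x \<in> I"
      using that assms by (auto simp: coset_def congr_def ideal_def)
    then have "mult (x - u) v + mult x (y - v) \<in> I"
      using subspace_add[OF s] by (simp add: mult_commute)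
    then have "mult x y - mult u v \<in> I" by (simp add: mult_simps)
    then show ?thesis using coset_eq_iff[OF assms] by metis
  qed
  have "x \<in> coset I x" "y \<in> coset I y"
    using subspace_0[OF s] by (auto simp: coset_def congr_def)
  with eq show ?thesis unfolding quot_mult_def by blast
qed

lemma quot_eq: "quot I = range (coset I)"
  by (auto simp: quot_def quotient_def coset_def)

lemma upper_ann_ideal: "ideal (upper_ann i)"
  and upper_ann_Suc_iff: "x \<in> upper_ann (Suc i) \<longleftrightarrow> (\<forall>y. mult x y \<in> upper_ann i)"
proof -
  have *: "x \<in> upper_ann (Suc i) \<longleftrightarrow> (\<forall>y. mult x y \<in> upper_ann i)"
    if "ideal (upper_ann i)" for x i
  proof -
    let ?I = "upper_ann i"
    have "quot_mult ?I (coset ?I x) ` quot ?I = (\<lambda>y. coset ?I (mult x y)) ` UNIV"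
      by (simp add: quot_eq image_image quot_mult_coset[OF that])
    moreover have "(\<lambda>y. coset ?I (mult x y)) ` UNIV = {coset ?I 0} \<longleftrightarrow>
        (\<forall>y. coset ?I (mult x y) = coset ?I 0)"
      by blast
    moreover have "coset ?I x \<in> quot ?I" by (simp add: quot_eq)
    ultimately show ?thesis
      unfolding upper_ann.simps annihilator_def mem_Collect_eq
      by (simp only: coset_eq_iff[OF that]) simp
  qed
  show id: "ideal (upper_ann i)" for i
  proof (induction i)
    case 0
    then show ?case by (simp add: ideal_def mult_simps)
  next
    case (Suc i)
    then have "subspace (upper_ann i)" by (simp add: ideal_def)
    then have "subspace (upper_ann (Suc i))"
      unfolding subspace_def Ball_def *[OF Suc] by (simp add: mult_simps del: upper_ann.simps)
    moreover have "mult x y \<in> upper_ann (Suc i)" if "x \<in> upper_ann (Suc i)" for x y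
      using that Suc unfolding *[OF Suc] by (auto simp: ideal_def)
    ultimately show ?case unfolding ideal_def by blast
  qed
  show "x \<in> upper_ann (Suc i) \<longleftrightarrow> (\<forall>y. mult x y \<in> upper_ann i)"
    using * id by blast
qed

lemma upper_ann_mono: "upper_ann i \<subseteq> upper_ann (Suc i)"
  using upper_ann_ideal[of i] unfolding ideal_def upper_ann_Suc_iff subset_iff by blast

lemma upper_ann_quot:
  "coset (upper_ann i) ` upper_ann (Suc i) =
     annihilator (quot (upper_ann i)) (quot_mult (upper_ann i)) (coset (upper_ann i) 0)"
  by (auto simp: annihilator_def quot_eq)

lemma type_exists_unique: "\<exists>!ns. is_type ns"
proof -
  interpret fd: finite_dimensional_vector_space scale "e ` \<Lambda>"
    by unfold_locales (simp_all add: finite_index independent_basis span_basis)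
  define d where "d i = dim (upper_ann i)" for i
  have d0: "d 0 = 0"
    using dim_span[of "{}"] by (simp add: d_def)
  have mono: "d i \<le> d (Suc i)" for i
    unfolding d_def by (rule fd.dim_subset[OF upper_ann_mono])
  define ns where "ns = map (\<lambda>i. d (Suc i) - d i) [0..<asi]"
  have "(\<Sum>j = 1..i. ns ! (j - 1)) = d i" if "i \<le> asi" for i
    using that by (induction i) (auto simp: d0 ns_def mono)
  then have ex: "is_type ns"
    by (auto simp: is_type_def ns_def d_def)
  have "ms = ns" if ms: "is_type ms" for ms
  proof (rule nth_equalityI)
    show "length ms = length ns" using ms ex by (simp add: is_type_def)
    fix i assume "i < length ms"
    then have i: "i < asi" using ms by (simp add: is_type_def)
    have *: "(\<Sum>j = 1..k. ms ! (j - 1)) = (\<Sum>j = 1..k. ns ! (j - 1))" if "k \<le> asi" for k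
      using ms ex that by (cases "k = 0") (auto simp: is_type_def)
    show "ms ! i = ns ! i"
      using *[of i] *[of "Suc i"] i by simp
  qed
  with ex show ?thesis by blast
qed

end

end

theory Submission
  imports Defs
begin

text \<open>
  Each term of the upper annihilating series is spanned by natural basis vectors:
  \<open>upper_ann i = span (e ` lambda_set i)\<close> (lemma \<open>upper_ann_eq_span\<close>). Indeed, if
  \<open>x = (\<Sum>k\<in>\<Lambda>. scale (c k) (e k))\<close>, then multiplying \<open>x\<close> by \<open>e j\<close> leaves only
  \<open>scale (c j) (mult (e j) (e j))\<close>. So \<open>x\<close> lies in \<open>upper_ann (Suc i)\<close> exactly when
  \<open>mult (e j) (e j)\<close> lies in \<open>upper_ann i\<close> for every \<open>j\<close> with \<open>c j \<noteq> 0\<close>; by induction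
  and independence of the basis, this says \<open>D1 j \<subseteq> lambda_set i\<close>, that is,
  \<open>j \<in> lambda_set (Suc i)\<close>. Hence \<open>dim (upper_ann i) = card (lambda_set i)\<close>, and the entries
  of the type, whose partial sums are these dimensions, are the successive differences.
\<close>

context evolution_algebra
begin

lemma basis_sum_in_span_iff:
  assumes S: "S \<subseteq> \<Lambda>"
  shows "(\<Sum>k\<in>\<Lambda>. scale (c k) (e k)) \<in> span (e ` S) \<longleftrightarrow> {k \<in> \<Lambda>. c k \<noteq> 0} \<subseteq> S"
proof
  assume sum: "(\<Sum>k\<in>\<Lambda>. scale (c k) (e k)) \<in> span (e ` S)"
  show "{k \<in> \<Lambda>. c k \<noteq> 0} \<subseteq> S"
  proof (rule ccontr)
    assume "\<not> {k \<in> \<Lambda>. c k \<noteq> 0} \<subseteq> S"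
    then obtain k where k: "k \<in> \<Lambda>" "c k \<noteq> 0" "k \<notin> S" by blast
    let ?V = "span (e ` (\<Lambda> - {k}))"
    have "(\<Sum>j\<in>\<Lambda> - {k}. scale (c j) (e j)) \<in> ?V"
      by (intro span_sum span_scale span_base) auto
    moreover have "(\<Sum>j\<in>\<Lambda>. scale (c j) (e j)) \<in> ?V"
      using sum span_mono[of "e ` S" "e ` (\<Lambda> - {k})"] S k(3) by blast
    ultimately have "(\<Sum>j\<in>\<Lambda>. scale (c j) (e j)) - (\<Sum>j\<in>\<Lambda> - {k}. scale (c j) (e j)) \<in> ?V"
      by (metis span_diff)
    then have "scale (c k) (e k) \<in> ?V"
      by (simp add: sum.remove[OF finite_index k(1)])
    then have "e k \<in> ?V"
      using k(2) span_scale[of "scale (c k) (e k)" _ "inverse (c k)"] by simp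
    moreover have "e ` (\<Lambda> - {k}) = e ` \<Lambda> - {e k}"
      using inj_basis k(1) by (auto simp: inj_on_def)
    ultimately show False
      using independent_basis k(1) by (auto simp: dependent_def)
  qed
next
  assume supp: "{k \<in> \<Lambda>. c k \<noteq> 0} \<subseteq> S"
  show "(\<Sum>k\<in>\<Lambda>. scale (c k) (e k)) \<in> span (e ` S)"
  proof (rule span_sum)
    fix k assume "k \<in> \<Lambda>"
    then show "scale (c k) (e k) \<in> span (e ` S)"
      using supp by (cases "c k = 0") (auto intro: span_zero span_scale span_base)
  qed
qed

lemma basis_expansion:
  obtains c where "x = (\<Sum>k\<in>\<Lambda>. scale (c k) (e k))"
proof -
  have "x \<in> span (e ` \<Lambda>)" by (simp add: span_basis)
  then obtain u where "x = (\<Sum>b\<in>e ` \<Lambda>. scale (u b) b)"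
    using finite_index by (auto simp: span_finite)
  then have "x = (\<Sum>k\<in>\<Lambda>. scale (u (e k)) (e k))"
    by (simp add: sum.reindex[OF inj_basis])
  then show thesis by (rule that)
qed

lemma mult_basis_sum:
  assumes "finite T"
  shows "mult (\<Sum>k\<in>T. scale (c k) (e k)) y = (\<Sum>k\<in>T. scale (c k) (mult (e k) y))"
  using assms by (induction T) (simp_all add: mult_simps)

lemma mult_basis_sum_basis:
  assumes j: "j \<in> \<Lambda>"
  shows "mult (\<Sum>k\<in>\<Lambda>. scale (c k) (e k)) (e j) = scale (c j) (mult (e j) (e j))"
proof -
  have "(\<Sum>k\<in>\<Lambda>. scale (c k) (mult (e k) (e j)))
      = (\<Sum>k\<in>\<Lambda>. if k = j then scale (c j) (mult (e j) (e j)) else 0)"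
    using j by (intro sum.cong) (auto simp: mult_basis_distinct)
  then show ?thesis
    using j finite_index by (simp add: mult_basis_sum)
qed

lemma lambda_set_subset: "lambda_set i \<subseteq> \<Lambda>"
  by (cases i rule: lambda_set.cases) auto

text \<open>The two separate clauses of the definition, \<open>i = 1\<close> and \<open>i > 1\<close>, obey one rule.\<close>

lemma lambda_set_Suc:
  "lambda_set (Suc i) = {j \<in> \<Lambda>. mult (e j) (e j) \<in> span (e ` lambda_set i)}"
proof (cases i)
  case 0
  then show ?thesis by simp
next
  case (Suc n)
  then show ?thesis
    using basis_sum_in_span_iff[OF lambda_set_subset[of i]]
    by (auto simp: mult_basis_square D1_def)
qed

lemma upper_ann_Suc_basis_sum_iff:
  "(\<Sum>k\<in>\<Lambda>. scale (c k) (e k)) \<in> upper_ann (Suc i)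
    \<longleftrightarrow> (\<forall>j\<in>\<Lambda>. c j \<noteq> 0 \<longrightarrow> mult (e j) (e j) \<in> upper_ann i)"
proof -
  let ?x = "\<Sum>k\<in>\<Lambda>. scale (c k) (e k)"
  have sub: "subspace (upper_ann i)" using upper_ann_ideal[of i] by (simp add: ideal_def)
  have "(\<forall>y. mult ?x y \<in> upper_ann i) \<longleftrightarrow> (\<forall>j\<in>\<Lambda>. mult ?x (e j) \<in> upper_ann i)"
  proof
    assume basis: "\<forall>j\<in>\<Lambda>. mult ?x (e j) \<in> upper_ann i"
    show "\<forall>y. mult ?x y \<in> upper_ann i"
    proof
      fix y
      obtain d where y: "y = (\<Sum>k\<in>\<Lambda>. scale (d k) (e k))" by (rule basis_expansion)
      have "mult ?x y = (\<Sum>k\<in>\<Lambda>. scale (d k) (mult ?x (e k)))"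
        using mult_basis_sum[OF finite_index, of d ?x] by (simp add: y mult_commute)
      also have "\<dots> \<in> upper_ann i"
        by (intro subspace_sum[OF sub] subspace_scale[OF sub]) (use basis in blast)
      finally show "mult ?x y \<in> upper_ann i" .
    qed
  qed blast
  moreover have "scale a v \<in> upper_ann i \<longleftrightarrow> a = 0 \<or> v \<in> upper_ann i" for a v
    using subspace_scale[OF sub, of v a] subspace_scale[OF sub, of "scale a v" "inverse a"]
      subspace_0[OF sub] by (cases "a = 0") auto
  ultimately show ?thesis
    unfolding upper_ann_Suc_iff by (auto simp: mult_basis_sum_basis)
qed

lemma upper_ann_eq_span: "upper_ann i = span (e ` lambda_set i)"
proof (induction i)
  case 0
  then show ?case by simp
next
  case (Suc i)
  show ?case
  proof (rule set_eqI)
    fix x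
    obtain c where x: "x = (\<Sum>k\<in>\<Lambda>. scale (c k) (e k))" by (rule basis_expansion)
    show "x \<in> upper_ann (Suc i) \<longleftrightarrow> x \<in> span (e ` lambda_set (Suc i))"
      unfolding x upper_ann_Suc_basis_sum_iff basis_sum_in_span_iff[OF lambda_set_subset]
      by (auto simp: lambda_set_Suc Suc.IH)
  qed
qed

lemma dim_upper_ann: "dim (upper_ann i) = card (lambda_set i)"
proof -
  have "independent (e ` lambda_set i)"
    by (rule independent_mono[OF independent_basis image_mono[OF lambda_set_subset]])
  then have "dim (upper_ann i) = card (e ` lambda_set i)"
    by (simp add: upper_ann_eq_span dim_eq_card_independent)
  also have "\<dots> = card (lambda_set i)"
    by (rule card_image[OF inj_on_subset[OF inj_basis lambda_set_subset]])
  finally show ?thesis .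
qed

lemma sum_type_eq_card:
  assumes "is_type ns" "i \<le> asi"
  shows "(\<Sum>j = 1..i. ns ! (j - 1)) = card (lambda_set i)"
  using assms by (cases "i = 0") (auto simp: is_type_def dim_upper_ann)

lemma type_nth_eq_card_diff:
  assumes type: "is_type ns" and i: "i \<in> {1..asi}"
  shows "int (ns ! (i - 1)) = int (card (lambda_set i)) - int (card (lambda_set (i - 1)))"
proof -
  obtain n where n: "i = Suc n" using i by (cases i) auto
  have "card (lambda_set (Suc n)) = card (lambda_set n) + ns ! n"
    using sum_type_eq_card[OF type, of n] sum_type_eq_card[OF type, of "Suc n"] i n by simp
  then show ?thesis using n by simp
qed

end

theorem corollary3p7:
  fixes scale :: "'k::field \<Rightarrow> 'a::ab_group_add \<Rightarrow> 'a"
    and mult :: "'a \<Rightarrow> 'a \<Rightarrow> 'a"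
    and \<Lambda> :: "'i set"
    and e :: "'i \<Rightarrow> 'a"
    and w :: "'i \<Rightarrow> 'i \<Rightarrow> 'k"
    and ns :: "nat list"
  assumes "evolution_algebra scale mult \<Lambda> e w"
    and "nonassoc_algebra.nilpotent scale mult"
    and "nonassoc_algebra.is_type scale mult ns"
  shows "\<forall>i\<in>{1..nonassoc_algebra.asi mult}.
    int (ns ! (i - 1)) =
      int (card (evolution_algebra.lambda_set mult \<Lambda> e w i))
      - int (card (evolution_algebra.lambda_set mult \<Lambda> e w (i - 1)))"
  using evolution_algebra.type_nth_eq_card_diff[OF assms(1,3)] by blast

end
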